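(* Let $2\le k\le n-2$. The set of cyclic fixed points in $X(k,n)$ injects into the set of $T_n$-orbits of aperiodic cyclic fixed points in $G(k,n)$.
   Context: $X(k,n)$ is the set of complex $k\times n$ matrices all of whose maximal minors are nonzero, modulo left multiplication by $SL(k)$ and right multiplication by the torus $(\mathbb{C}^* )^n$ of invertible diagonal matrices (equivalently, modulo $GL(k)\times(\mathbb{C}^* )^n$). A cyclic fixed point in $X(k,n)$ is a class fixed by the cyclic shift of columns $[(v_1,\ldots,v_n)]\mapsto[(v_2,\ldots,v_n,v_1)]$. $G(k,n)$ is the Grassmannian of complex $k\times n$ matrices of rank $k$ modulo left multiplication by $GL(k)$. Let $\rho_n\in GL(n)$ be given by $\rho_n(e_j)=e_{j-1}$ (indices modulo $n$), acting on $G(k,n)$ by $g\mapsto g\cdot\rho_n^{-1}$, i.e. by cyclically shifting the columns. A cyclic fixed point in $G(k,n)$ is a point of $G(k,n)$ fixed by this action. Let $q=\exp(2\pi i/n)$, and let $T_n\simeq\mathbb{Z}/n$ be the subgroup of diagonal matrices $\mathrm{diag}(1,q^a,q^{2a},\ldots,q^{(n-1)a})$, $a\in\mathbb{Z}/n$, of $GL(n)$, acting on $G(k,n)$ by right multiplication; it maps cyclic fixed points to cyclic fixed points. A cyclic fixed point $g\in G(k,n)$ is called aperiodic if its $T_n$-orbit consists of exactly $n$ distinct cyclic fixed points. *)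

theory Defs
  imports Complex_Main "Jordan_Normal_Form.DL_Rank_Submatrix"
begin

text \<open>Columns of a \<open>k \<times> n\<close> matrix are indexed by \<open>0, \<dots>, n - 1\<close>.\<close>

definition SL :: "nat \<Rightarrow> complex mat set" where
  "SL k = {P \<in> carrier_mat k k. det P = 1}"

definition GL :: "nat \<Rightarrow> complex mat set" where
  "GL k = {P \<in> carrier_mat k k. invertible_mat P}"

definition torus :: "nat \<Rightarrow> complex mat set" where
  "torus n = {mat_diag n t | t. \<forall>j<n. t j \<noteq> 0}"

text \<open>The shift \<open>(v\<^sub>1, \<dots>, v\<^sub>n) \<mapsto> (v\<^sub>2, \<dots>, v\<^sub>n, v\<^sub>1)\<close> of columns. It is right
  multiplication by the inverse of the matrix \<open>rho n\<close> of \<open>e\<^sub>j \<mapsto> e\<^sub>j\<^sub>-\<^sub>1\<close>.\<close>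

definition cyc_shift :: "complex mat \<Rightarrow> complex mat" where
  "cyc_shift A = mat (dim_row A) (dim_col A) (\<lambda>(i, j). A $$ (i, (j + 1) mod dim_col A))"

definition rho :: "nat \<Rightarrow> complex mat" where
  "rho n = mat n n (\<lambda>(i, j). if (i + 1) mod n = j then 1 else 0)"

lemma sum_if_mult:
  fixes c n :: nat
  assumes "c < n"
  shows "(\<Sum>l = 0..<n. f l * (if c = l then 1 else 0)) = (f c :: complex)"
proof -
  have "(\<Sum>l = 0..<n. f l * (if c = l then 1 else 0)) = (\<Sum>l = 0..<n. if c = l then f l else 0)"
    by (intro sum.cong) auto
  also have "\<dots> = f c" using assms by simp
  finally show ?thesis .
qed

lemma rho_inverse:
  "rho n * transpose_mat (rho n) = 1\<^sub>m n" "transpose_mat (rho n) * rho n = 1\<^sub>m n"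
proof -
  have inj: "i = j" if "Suc i mod n = Suc j mod n" "i < n" "j < n" for i j
    using that by (auto simp: mod_Suc split: if_splits)
  show 1: "rho n * transpose_mat (rho n) = 1\<^sub>m n"
  proof (rule eq_matI)
    fix i j assume "i < dim_row (1\<^sub>m n :: complex mat)" "j < dim_col (1\<^sub>m n :: complex mat)"
    then have ij: "i < n" "j < n" by auto
    then have "(rho n * transpose_mat (rho n)) $$ (i, j) = (if Suc i mod n = Suc j mod n then 1 else 0)"
      by (auto simp: rho_def scalar_prod_def sum_if_mult)
    then show "(rho n * transpose_mat (rho n)) $$ (i, j) = 1\<^sub>m n $$ (i, j)"
      using ij inj[of i j] by (cases "i = j") auto
  qed (auto simp: rho_def)
  show "transpose_mat (rho n) * rho n = 1\<^sub>m n"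
    by (rule mat_mult_left_right_inverse[OF _ _ 1]) (auto simp: rho_def)
qed

lemma cyc_shift_eq_mult:
  assumes "A \<in> carrier_mat k n"
  shows "cyc_shift A = A * transpose_mat (rho n)"
proof (rule eq_matI)
  fix i j assume "i < dim_row (A * transpose_mat (rho n))" "j < dim_col (A * transpose_mat (rho n))"
  then have ij: "i < k" "j < n" using assms by (auto simp: rho_def)
  have "(A * transpose_mat (rho n)) $$ (i, j) = A $$ (i, Suc j mod n)"
    using ij assms
    by (auto simp: rho_def scalar_prod_def sum_if_mult)
  then show "cyc_shift A $$ (i, j) = (A * transpose_mat (rho n)) $$ (i, j)"
    using ij assms by (simp add: cyc_shift_def)
qed (use assms in \<open>auto simp: cyc_shift_def rho_def\<close>)

definition X_mats :: "nat \<Rightarrow> nat \<Rightarrow> complex mat set" where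
  "X_mats k n = {A \<in> carrier_mat k n.
     \<forall>J. J \<subseteq> {..<n} \<and> card J = k \<longrightarrow> det (submatrix A UNIV J) \<noteq> 0}"

definition X_rel :: "nat \<Rightarrow> nat \<Rightarrow> (complex mat \<times> complex mat) set" where
  "X_rel k n = {(A, B) \<in> X_mats k n \<times> X_mats k n. \<exists>P \<in> SL k. \<exists>D \<in> torus n. B = P * A * D}"

definition X_space :: "nat \<Rightarrow> nat \<Rightarrow> complex mat set set" where
  "X_space k n = X_mats k n // X_rel k n"

definition G_mats :: "nat \<Rightarrow> nat \<Rightarrow> complex mat set" where
  "G_mats k n = {A \<in> carrier_mat k n. vec_space.rank k A = k}"

definition G_rel :: "nat \<Rightarrow> nat \<Rightarrow> (complex mat \<times> complex mat) set" where
  "G_rel k n = {(A, B) \<in> G_mats k n \<times> G_mats k n. \<exists>P \<in> GL k. B = P * A}"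

definition Gr :: "nat \<Rightarrow> nat \<Rightarrow> complex mat set set" where
  "Gr k n = G_mats k n // G_rel k n"

text \<open>Points of \<open>X_space k n\<close> and \<open>Gr k n\<close> are equivalence classes of matrices. The column shift and right
  multiplication by an invertible diagonal matrix are bijective on representatives and map
  classes onto classes, so they act on points by taking images.\<close>

definition cyclic_fixed_points_X :: "nat \<Rightarrow> nat \<Rightarrow> complex mat set set" where
  "cyclic_fixed_points_X k n = {x \<in> X_space k n. cyc_shift ` x = x}"

definition cyclic_fixed_points_G :: "nat \<Rightarrow> nat \<Rightarrow> complex mat set set" where
  "cyclic_fixed_points_G k n = {p \<in> Gr k n. cyc_shift ` p = p}"

definition root_q :: "nat \<Rightarrow> complex" where
  "root_q n = exp (2 * of_real pi * \<i> / of_nat n)"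

definition T_group :: "nat \<Rightarrow> complex mat set" where
  "T_group n = {mat_diag n (\<lambda>j. root_q n ^ (j * a)) | a. a < n}"

definition T_orbit :: "nat \<Rightarrow> complex mat set \<Rightarrow> complex mat set set" where
  "T_orbit n p = (\<lambda>D. (\<lambda>A. A * D) ` p) ` T_group n"

definition aperiodic_fixed_points_G :: "nat \<Rightarrow> nat \<Rightarrow> complex mat set set" where
  "aperiodic_fixed_points_G k n =
     {p \<in> cyclic_fixed_points_G k n. T_orbit n p \<subseteq> cyclic_fixed_points_G k n \<and> card (T_orbit n p) = n}"

definition aperiodic_orbits :: "nat \<Rightarrow> nat \<Rightarrow> complex mat set set set" where
  "aperiodic_orbits k n = T_orbit n ` aperiodic_fixed_points_G k n"

end

theory Submission
  imports Defs
begin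

text \<open>Let \<open>x\<close> be a cyclic fixed point of \<open>X(k,n)\<close> and \<open>A \<in> x\<close> with columns \<open>v\<^sub>0, \<dots>, v\<^sub>n\<^sub>-\<^sub>1\<close>. That
  \<open>x\<close> is fixed means \<open>v\<^sub>j\<^sub>+\<^sub>1 = t\<^sub>j Q v\<^sub>j\<close>, indices modulo \<open>n\<close>, for some invertible \<open>Q\<close> and nonzero
  scalars \<open>t\<^sub>j\<close>. Rescaling the columns changes \<open>t\<close> by a coboundary of the cyclic group, and only
  the product of all \<open>t\<^sub>j\<close> is an obstruction to making them equal to \<open>1\<close>. Absorbing an \<open>n\<close>-th root
  \<open>c\<close> of that product into \<open>Q\<close> removes it (\<open>constant_cocycle_representative\<close>,
  \<open>cyc_shift_rescale\<close>). So \<open>x\<close> contains a matrix \<open>B\<close> whose shift is \<open>(c Q) B\<close>, and the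
  \<open>GL(k)\<close>-class of \<open>B\<close> is a cyclic fixed point of \<open>G(k,n)\<close> lying inside \<open>x\<close>.

  This point is aperiodic because a point of \<open>G(k,n)\<close> with nonzero maximal minors is fixed only by
  the scalar elements of the torus when \<open>1 \<le> k < n\<close> (\<open>torus_stabilizer_scalar\<close>), and
  \<open>diag(1, q\<^sup>a, q\<^sup>2\<^sup>a, \<dots>)\<close> is scalar only for \<open>q\<^sup>a = 1\<close>. Its \<open>T\<^sub>n\<close>-orbit consists of cyclic fixed
  points because multiplying column \<open>j\<close> by \<open>q\<^sup>j\<^sup>a\<close> multiplies \<open>c Q\<close> by the scalar \<open>q\<^sup>a\<close>.

  The map sends \<open>x\<close> to the \<open>T\<^sub>n\<close>-orbit of such a point. As \<open>T\<^sub>n\<close> lies in the torus, all points of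
  this orbit are subsets of \<open>x\<close>. Distinct classes in \<open>X(k,n)\<close> are disjoint, so the orbit
  determines \<open>x\<close>, which is injectivity.\<close>

section \<open>The groups acting on matrices\<close>

lemma GL_iff_det: "P \<in> GL k \<longleftrightarrow> P \<in> carrier_mat k k \<and> det P \<noteq> 0"
proof (intro iffI conjI)
  assume "P \<in> GL k"
  then have P: "P \<in> carrier_mat k k" and "invertible_mat P" by (auto simp: GL_def)
  then obtain Q where Q: "P * Q = 1\<^sub>m k" "Q * P = 1\<^sub>m (dim_row Q)"
    unfolding invertible_mat_def inverts_mat_def by auto
  have "dim_row Q = k" using arg_cong[OF Q(2), of dim_col] P by simp
  moreover have "dim_col Q = k" using arg_cong[OF Q(1), of dim_col] by simp
  ultimately have "Q \<in> carrier_mat k k" by (rule carrier_matI)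
  then have "det P * det Q = 1" using P Q(1) by (simp flip: det_mult)
  then show "P \<in> carrier_mat k k" "det P \<noteq> 0" using P by auto
next
  assume *: "P \<in> carrier_mat k k \<and> det P \<noteq> 0"
  then have "P \<in> Units (ring_mat TYPE(complex) k ())" by (intro det_non_zero_imp_unit) auto
  then obtain Q where "Q \<in> carrier_mat k k" "Q * P = 1\<^sub>m k" "P * Q = 1\<^sub>m k"
    by (auto simp: Units_def ring_mat_simps)
  with * show "P \<in> GL k"
    by (auto simp: GL_def invertible_mat_def inverts_mat_def)
qed

lemma GL_carrier: "P \<in> GL k \<Longrightarrow> P \<in> carrier_mat k k"
  by (simp add: GL_iff_det)

lemma GL_one: "1\<^sub>m k \<in> GL k"
  by (simp add: GL_iff_det)

lemma GL_mult: "P \<in> GL k \<Longrightarrow> Q \<in> GL k \<Longrightarrow> P * Q \<in> GL k"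
  by (auto simp: GL_iff_det det_mult)

lemma GL_smult: "P \<in> GL k \<Longrightarrow> c \<noteq> 0 \<Longrightarrow> c \<cdot>\<^sub>m P \<in> GL k"
  by (auto simp: GL_iff_det)

lemma GL_inverse:
  assumes "P \<in> GL k"
  obtains Q where "Q \<in> GL k" "Q * P = 1\<^sub>m k" "P * Q = 1\<^sub>m k"
proof -
  have P: "P \<in> carrier_mat k k" "det P \<noteq> 0" using assms by (auto simp: GL_iff_det)
  then have "P \<in> Units (ring_mat TYPE(complex) k ())" by (intro det_non_zero_imp_unit) auto
  then obtain Q where Q: "Q \<in> carrier_mat k k" "Q * P = 1\<^sub>m k" "P * Q = 1\<^sub>m k"
    by (auto simp: Units_def ring_mat_simps)
  then have "det Q * det P = 1" using P by (simp flip: det_mult)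
  then have "Q \<in> GL k" using Q by (auto simp: GL_iff_det)
  with Q that show thesis by blast
qed

lemma SL_subset_GL: "SL k \<subseteq> GL k"
  by (auto simp: SL_def GL_iff_det)

lemma torus_carrier: "D \<in> torus n \<Longrightarrow> D \<in> carrier_mat n n"
  by (auto simp: torus_def)

lemma mat_diag_in_torus: "(\<And>j. j < n \<Longrightarrow> t j \<noteq> 0) \<Longrightarrow> mat_diag n t \<in> torus n"
  by (auto simp: torus_def)

lemma torus_one: "1\<^sub>m n \<in> torus n"
  using mat_diag_in_torus[of n "\<lambda>_. 1"] by simp

lemma torus_mult: "D \<in> torus n \<Longrightarrow> E \<in> torus n \<Longrightarrow> D * E \<in> torus n"
  by (auto simp: torus_def)

lemma mat_diag_eq_oneI: "(\<And>j. j < n \<Longrightarrow> t j = 1) \<Longrightarrow> mat_diag n t = 1\<^sub>m n"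
  by (rule eq_matI) (auto simp: mat_diag_def)

lemma torus_inverse:
  assumes "D \<in> torus n"
  obtains E where "E \<in> torus n" "D * E = 1\<^sub>m n"
proof -
  obtain t where t: "D = mat_diag n t" "\<And>j. j < n \<Longrightarrow> t j \<noteq> 0" using assms by (auto simp: torus_def)
  show thesis
  proof (rule that)
    show "mat_diag n (\<lambda>j. inverse (t j)) \<in> torus n" using t by (auto intro: mat_diag_in_torus)
    show "D * mat_diag n (\<lambda>j. inverse (t j)) = 1\<^sub>m n"
      using t by (auto intro: mat_diag_eq_oneI)
  qed
qed

lemma two_sided_mult:
  assumes "P \<in> carrier_mat k k" "Q \<in> carrier_mat k k" "A \<in> carrier_mat k n"
    "D \<in> carrier_mat n n" "E \<in> carrier_mat n n"
  shows "Q * (P * A * D) * E = (Q * P) * A * (D * E)"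
proof -
  have "Q * (P * A * D) * E = Q * (P * A) * D * E"
    using assms by (subst assoc_mult_mat[of Q k k "P * A" n D n]) auto
  also have "\<dots> = (Q * P) * A * D * E"
    using assms by (subst assoc_mult_mat[of Q k k P k A n]) auto
  also have "\<dots> = (Q * P) * A * (D * E)"
    using assms by (intro assoc_mult_mat[of _ k n _ n _ n]) auto
  finally show ?thesis .
qed

section \<open>Maximal minors\<close>

lemma submatrix_UNIV_eq:
  assumes "A \<in> carrier_mat k n" "J \<subseteq> {..<n}"
  shows "submatrix A UNIV J = mat k (card J) (\<lambda>(i, j). A $$ (i, pick J j))"
proof -
  have "{j. j < n \<and> j \<in> J} = J" using assms(2) by auto
  then show ?thesis using assms(1) by (simp add: submatrix_def pick_UNIV)
qed

lemma pick_less: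
  assumes "J \<subseteq> {..<n}" "j < card J"
  shows "pick J j < n"
  using pick_in_set[of j J] assms by auto

lemma bij_betw_pick:
  assumes "finite J"
  shows "bij_betw (pick J) {..<card J} J"
proof -
  have inj: "inj_on (pick J) {..<card J}"
    using pick_mono[of _ J] by (intro inj_onI) (metis lessThan_iff linorder_neqE_nat order_less_irrefl)
  moreover have "pick J ` {..<card J} \<subseteq> J" using pick_in_set[of _ J] by auto
  then have "pick J ` {..<card J} = J"
    using assms inj by (intro card_subset_eq) (auto simp: card_image)
  ultimately show ?thesis by (simp add: bij_betw_def)
qed

lemma det_mat_diag: "det (mat_diag m t) = (\<Prod>j<m. t j)"
proof -
  have "det (mat_diag m t) = prod_list (diag_mat (mat_diag m t))"
    by (rule det_upper_triangular[of _ m]) (auto simp: mat_diag_def)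
  also have "\<dots> = (\<Prod>j<m. t j)"
    by (auto simp: prod_list_diag_prod mat_diag_def atLeast0LessThan)
  finally show ?thesis .
qed

lemma det_submatrix_left_mult:
  assumes "P \<in> carrier_mat k k" "A \<in> carrier_mat k n" "J \<subseteq> {..<n}" "card J = k"
  shows "det (submatrix (P * A) UNIV J) = det P * det (submatrix A UNIV J)"
proof -
  have "submatrix (P * A) UNIV J = P * submatrix A UNIV J"
  proof (rule eq_matI)
    fix i j assume "i < dim_row (P * submatrix A UNIV J)" "j < dim_col (P * submatrix A UNIV J)"
    then have ij: "i < k" "j < k" using assms by (auto simp: submatrix_UNIV_eq)
    moreover have "pick J j < n" using pick_less assms ij by blast
    ultimately show "submatrix (P * A) UNIV J $$ (i, j) = (P * submatrix A UNIV J) $$ (i, j)"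
      using assms by (auto simp: submatrix_UNIV_eq[of _ k n] scalar_prod_def intro!: sum.cong)
  qed (use assms in \<open>auto simp: submatrix_UNIV_eq[of _ k n]\<close>)
  then show ?thesis using assms by (simp add: det_mult[of _ k] submatrix_UNIV_eq)
qed

lemma det_submatrix_right_diag:
  assumes "A \<in> carrier_mat k n" "J \<subseteq> {..<n}" "card J = k"
  shows "det (submatrix (A * mat_diag n t) UNIV J) = det (submatrix A UNIV J) * (\<Prod>j\<in>J. t j)"
proof -
  have "submatrix (A * mat_diag n t) UNIV J = submatrix A UNIV J * mat_diag k (\<lambda>j. t (pick J j))"
  proof (rule eq_matI)
    fix i j assume "i < dim_row (submatrix A UNIV J * mat_diag k (\<lambda>j. t (pick J j)))"
      "j < dim_col (submatrix A UNIV J * mat_diag k (\<lambda>j. t (pick J j)))"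
    then have ij: "i < k" "j < k" using assms by (auto simp: submatrix_UNIV_eq mat_diag_def)
    moreover have "pick J j < n" using pick_less assms ij by blast
    ultimately show "submatrix (A * mat_diag n t) UNIV J $$ (i, j) =
        (submatrix A UNIV J * mat_diag k (\<lambda>j. t (pick J j))) $$ (i, j)"
      using assms
      by (simp add: submatrix_UNIV_eq[of _ k n] mat_diag_mult_right[of _ k n] mat_diag_mult_right[of _ k k])
  qed (use assms in \<open>auto simp: submatrix_UNIV_eq[of _ k n] mat_diag_def\<close>)
  moreover have "(\<Prod>j<k. t (pick J j)) = (\<Prod>j\<in>J. t j)"
    using assms bij_betw_pick[of J] finite_subset[of J "{..<n}"]
    by (intro prod.reindex_bij_betw) auto
  ultimately show ?thesis using assms
    by (simp add: det_mult[of _ k] submatrix_UNIV_eq det_mat_diag)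
qed

lemma X_mats_carrier: "A \<in> X_mats k n \<Longrightarrow> A \<in> carrier_mat k n"
  by (simp add: X_mats_def)

text \<open>Minors change only by \<open>det P\<close> and by a product of entries of \<open>D\<close>, hence by nonzero factors.\<close>

lemma X_mats_two_sided_mult:
  assumes A: "A \<in> X_mats k n" and P: "P \<in> GL k" and D: "D \<in> torus n"
  shows "P * A * D \<in> X_mats k n"
proof -
  obtain t where t: "D = mat_diag n t" "\<And>j. j < n \<Longrightarrow> t j \<noteq> 0" using D by (auto simp: torus_def)
  have c: "A \<in> carrier_mat k n" "P \<in> carrier_mat k k" using A P by (auto simp: X_mats_def GL_iff_det)
  have "det (submatrix (P * A * D) UNIV J) \<noteq> 0" if J: "J \<subseteq> {..<n}" "card J = k" for J
  proof -
    have "det (submatrix (P * A * D) UNIV J) = det P * det (submatrix A UNIV J) * (\<Prod>j\<in>J. t j)"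
      using c J by (simp add: t det_submatrix_right_diag[of _ k n] det_submatrix_left_mult)
    moreover have "(\<Prod>j\<in>J. t j) \<noteq> 0" using t J finite_subset[of J "{..<n}"] by auto
    ultimately show ?thesis using A P J by (auto simp: X_mats_def GL_iff_det)
  qed
  moreover have "P * A * D \<in> carrier_mat k n"
    using c torus_carrier[OF D] by auto
  ultimately show ?thesis by (simp add: X_mats_def)
qed

lemma X_mats_left_mult:
  assumes "A \<in> X_mats k n" "P \<in> GL k"
  shows "P * A \<in> X_mats k n"
  using X_mats_two_sided_mult[OF assms torus_one] X_mats_carrier[OF assms(1)] GL_carrier[OF assms(2)]
  by simp

lemma X_mats_right_mult:
  assumes "A \<in> X_mats k n" "D \<in> torus n"
  shows "A * D \<in> X_mats k n"
  using X_mats_two_sided_mult[OF assms(1) GL_one assms(2)] X_mats_carrier[OF assms(1)] by simp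

lemma (in vec_space) rank_le_rows:
  assumes "A \<in> carrier_mat n nc"
  shows "rank A \<le> n"
proof -
  obtain S where S: "maximal S (\<lambda>T. T \<subseteq> set (cols A) \<and> lin_indpt T)"
    using maximal_exists[of "(\<lambda>T. T \<subseteq> set (cols A) \<and> lin_indpt T)" "card (set (cols A))" "{}"]
    by (meson List.finite_set card_mono empty_iff empty_subsetI finite_lin_indpt2 rev_finite_subset)
  then have "S \<subseteq> carrier_vec n" "lin_indpt S" "finite S"
    using cols_dim[of A] assms by (auto simp: maximal_def intro: finite_subset)
  then show ?thesis using li_le_dim[of S] rank_card_indpt[OF assms S] fin_dim dim_is_n by simp
qed

lemma X_mats_subset_G_mats:
  assumes "k \<le> n"
  shows "X_mats k n \<subseteq> G_mats k n"
proof
  fix A assume A: "A \<in> X_mats k n"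
  have "{j. j < n \<and> j < k} = {..<k}" using assms by auto
  moreover have "det (submatrix A UNIV {..<k}) \<noteq> 0" using A assms by (auto simp: X_mats_def)
  ultimately have "k \<le> vec_space.rank k A"
    using vec_space.rank_gt_minor[of A k n UNIV "{..<k}"] X_mats_carrier[OF A] by simp
  then show "A \<in> G_mats k n"
    using vec_space.rank_le_rows[of A k n] X_mats_carrier[OF A] by (simp add: G_mats_def)
qed

text \<open>Taking the minor on columns \<open>J\<close> in \<open>R * B = B * mat_diag n t\<close> shows that \<open>\<Prod>l\<in>J. t l\<close> equals
  \<open>det R\<close>, independently of \<open>J\<close>. Two index sets that differ by exchanging \<open>i\<close> for \<open>j\<close>, which exist
  for \<open>1 \<le> k < n\<close>, force \<open>t i = t j\<close>.\<close>

lemma torus_stabilizer_scalar: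
  assumes B: "B \<in> X_mats k n" and k: "1 \<le> k" "k < n" and R: "R \<in> carrier_mat k k"
    and eq: "R * B = B * mat_diag n t" and ij: "i < n" "j < n" and nz: "\<And>l. l < n \<Longrightarrow> t l \<noteq> 0"
  shows "t i = t j"
proof (cases "i = j")
  case False
  have "k - 1 \<le> card ({..<n} - {i, j})" using False ij k by (simp add: card_Diff_subset)
  then obtain S where S: "S \<subseteq> {..<n} - {i, j}" "card S = k - 1" "finite S"
    by (rule obtain_subset_with_card_n)
  have minor: "det R = t l * (\<Prod>m\<in>S. t m)" if l: "l \<in> {i, j}" for l
  proof -
    have J: "insert l S \<subseteq> {..<n}" "card (insert l S) = k" "l \<notin> S"
      using S l ij k by (auto simp: card_insert_if)
    then have "det R * det (submatrix B UNIV (insert l S)) =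
        det (submatrix B UNIV (insert l S)) * (\<Prod>m\<in>insert l S. t m)"
      using R X_mats_carrier[OF B] eq
      by (metis det_submatrix_left_mult det_submatrix_right_diag)
    moreover have "det (submatrix B UNIV (insert l S)) \<noteq> 0" using B J by (auto simp: X_mats_def)
    ultimately show ?thesis using S J by simp
  qed
  have "(\<Prod>m\<in>S. t m) \<noteq> 0" using S nz by auto
  with minor[of i] minor[of j] show ?thesis by simp
qed simp

section \<open>The two quotient spaces\<close>

lemma complex_root_exists:
  fixes z :: complex
  assumes "m > 0"
  obtains c where "c ^ m = z"
proof -
  have "rcis (root m (norm z)) (Arg z / m) ^ m = z"
    using assms by (simp add: DeMoivre2 rcis_cmod_Arg)
  then show thesis by (rule that)
qed

text \<open>A scalar can be moved from \<open>P\<close> to \<open>D\<close>: dividing \<open>P\<close> by a \<open>k\<close>-th root of its determinant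
  brings it into \<open>SL k\<close>. So \<open>X(k,n)\<close> is also a quotient by \<open>GL(k)\<close> and the torus, and the
  \<open>GL(k)\<close>-class of any representative is contained in its class in \<open>X(k,n)\<close>.\<close>

lemma X_rel_iff:
  assumes "k > 0"
  shows "(A, B) \<in> X_rel k n \<longleftrightarrow> A \<in> X_mats k n \<and> (\<exists>P\<in>GL k. \<exists>D\<in>torus n. B = P * A * D)"
proof
  assume "(A, B) \<in> X_rel k n"
  then show "A \<in> X_mats k n \<and> (\<exists>P\<in>GL k. \<exists>D\<in>torus n. B = P * A * D)"
    using SL_subset_GL by (auto simp: X_rel_def)
next
  assume *: "A \<in> X_mats k n \<and> (\<exists>P\<in>GL k. \<exists>D\<in>torus n. B = P * A * D)"
  then obtain P D where A: "A \<in> X_mats k n" and P: "P \<in> GL k" and D: "D \<in> torus n" and B: "B = P * A * D"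
    by blast
  have c: "A \<in> carrier_mat k n" "P \<in> carrier_mat k k" "D \<in> carrier_mat n n"
    using A P D X_mats_carrier GL_carrier torus_carrier by auto
  obtain c where ck: "c ^ k = det P" using complex_root_exists[OF assms] .
  have c0: "c \<noteq> 0" using ck P assms by (auto simp: GL_iff_det power_0_left)
  have "inverse c \<cdot>\<^sub>m P \<in> SL k"
    using P by (auto simp: SL_def GL_iff_det power_inverse ck)
  moreover have "mat_diag n (\<lambda>_. c) * D \<in> torus n"
    using c0 D by (intro torus_mult mat_diag_in_torus) auto
  moreover have "B = (inverse c \<cdot>\<^sub>m P) * A * (mat_diag n (\<lambda>_. c) * D)"
  proof -
    have "mat_diag n (\<lambda>_. c) * D = c \<cdot>\<^sub>m D"
      using c by (subst mat_diag_mult_left[of _ n n]) auto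
    moreover have "(inverse c \<cdot>\<^sub>m P) * A * (c \<cdot>\<^sub>m D) = c \<cdot>\<^sub>m (inverse c \<cdot>\<^sub>m (P * A * D))"
      using c by (simp add: mult_smult_distrib[of _ k n _ n] mult_smult_assoc_mat[of _ k k _ n]
          mult_smult_assoc_mat[of _ k n _ n])
    moreover have "c \<cdot>\<^sub>m (inverse c \<cdot>\<^sub>m M) = M" for M :: "complex mat"
      using c0 by (intro eq_matI) auto
    ultimately show ?thesis by (simp add: B)
  qed
  ultimately show "(A, B) \<in> X_rel k n"
    using A X_mats_two_sided_mult[OF A P D] by (auto simp: X_rel_def B)
qed

lemma equiv_X_rel:
  assumes "k > 0"
  shows "equiv (X_mats k n) (X_rel k n)"
proof (rule equivI)
  show "X_rel k n \<subseteq> X_mats k n \<times> X_mats k n" by (auto simp: X_rel_def)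
  show "refl_on (X_mats k n) (X_rel k n)"
  proof (rule refl_onI)
    fix A assume A: "A \<in> X_mats k n"
    then have "A = 1\<^sub>m k * A * 1\<^sub>m n" using X_mats_carrier[OF A] by simp
    then show "(A, A) \<in> X_rel k n" using A GL_one torus_one by (auto simp: X_rel_iff[OF assms])
  qed
  show "sym (X_rel k n)"
  proof (rule symI)
    fix A B assume AB: "(A, B) \<in> X_rel k n"
    then obtain P D where A: "A \<in> X_mats k n" and P: "P \<in> GL k" and D: "D \<in> torus n" and B: "B = P * A * D"
      by (auto simp: X_rel_iff[OF assms])
    obtain Q where Q: "Q \<in> GL k" "Q * P = 1\<^sub>m k" using GL_inverse[OF P] by metis
    obtain E where E: "E \<in> torus n" "D * E = 1\<^sub>m n" using torus_inverse[OF D] by metis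
    have "Q * B * E = A"
      unfolding B
      using two_sided_mult[OF GL_carrier[OF P] GL_carrier[OF Q(1)] X_mats_carrier[OF A]
          torus_carrier[OF D] torus_carrier[OF E(1)]] Q(2) E(2) X_mats_carrier[OF A]
      by simp
    moreover have "B \<in> X_mats k n" using AB by (auto simp: X_rel_def)
    ultimately show "(B, A) \<in> X_rel k n" using Q E by (auto simp: X_rel_iff[OF assms])
  qed
  show "trans (X_rel k n)"
  proof (rule transI)
    fix A B C assume "(A, B) \<in> X_rel k n" "(B, C) \<in> X_rel k n"
    then obtain P D Q E where A: "A \<in> X_mats k n" and P: "P \<in> GL k" "Q \<in> GL k"
      and D: "D \<in> torus n" "E \<in> torus n" and C: "C = Q * (P * A * D) * E"
      by (auto simp: X_rel_iff[OF assms])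
    have "C = (Q * P) * A * (D * E)"
      unfolding C using A P D by (intro two_sided_mult[of _ k _ _ n]) (auto simp: GL_carrier torus_carrier X_mats_carrier)
    then show "(A, C) \<in> X_rel k n"
      using A GL_mult[OF P(2,1)] torus_mult[OF D] by (auto simp: X_rel_iff[OF assms])
  qed
qed

lemma X_space_two_sided_mult:
  assumes "k > 0" "x \<in> X_space k n" "A \<in> x" "P \<in> GL k" "D \<in> torus n"
  shows "P * A * D \<in> x"
proof -
  note eq = equiv_X_rel[OF assms(1), of n]
  have "A \<in> X_mats k n" using in_quotient_imp_subset[OF eq] assms(2,3) by (auto simp: X_space_def)
  then have "(A, P * A * D) \<in> X_rel k n" using assms by (auto simp: X_rel_iff)
  then show ?thesis using in_quotient_imp_closed[OF eq _ assms(3)] assms(2) by (auto simp: X_space_def)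
qed

definition GL_orbit :: "nat \<Rightarrow> complex mat \<Rightarrow> complex mat set" where
  "GL_orbit k B = (\<lambda>P. P * B) ` GL k"

lemma GL_orbit_in_Gr:
  assumes "B \<in> X_mats k n" "k \<le> n"
  shows "GL_orbit k B \<in> Gr k n"
proof -
  have "P * B \<in> G_mats k n" if "P \<in> GL k" for P
    using X_mats_left_mult[OF assms(1) that] X_mats_subset_G_mats[OF assms(2)] by auto
  then have "GL_orbit k B = G_rel k n `` {B}"
    using assms X_mats_subset_G_mats[OF assms(2)] by (auto simp: GL_orbit_def G_rel_def)
  moreover have "B \<in> G_mats k n" using assms X_mats_subset_G_mats by auto
  ultimately show ?thesis by (auto simp: Gr_def quotientI)
qed

lemma Gr_nonempty:
  assumes "p \<in> Gr k n"
  shows "p \<noteq> {}"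
proof -
  obtain A where A: "A \<in> G_mats k n" "p = G_rel k n `` {A}"
    using assms by (auto simp: Gr_def elim: quotientE)
  moreover have "A = 1\<^sub>m k * A"
    using A(1) left_mult_one_mat[of A k n] by (simp add: G_mats_def)
  ultimately have "A \<in> p" using GL_one by (auto simp: G_rel_def)
  then show ?thesis by blast
qed

lemma GL_orbit_self: "B \<in> carrier_mat k n \<Longrightarrow> B \<in> GL_orbit k B"
  unfolding GL_orbit_def using GL_one by (intro image_eqI[of _ _ "1\<^sub>m k"]) auto

lemma GL_orbit_left_mult:
  assumes Q: "Q \<in> GL k" and B: "B \<in> carrier_mat k n"
  shows "GL_orbit k (Q * B) = GL_orbit k B"
proof -
  obtain R where R: "R \<in> GL k" "R * Q = 1\<^sub>m k" using GL_inverse[OF Q] by metis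
  have *: "P * (Q * B) = (P * Q) * B" if "P \<in> GL k" for P
    using that Q B GL_carrier by (intro assoc_mult_mat[of _ k k _ k _ n, symmetric]) auto
  have "P * B = (P * R) * (Q * B)" if "P \<in> GL k" for P
  proof -
    have "(P * R) * Q = P"
      using assoc_mult_mat[OF GL_carrier[OF that] GL_carrier[OF R(1)] GL_carrier[OF Q]] R(2)
        GL_carrier[OF that] by simp
    then show ?thesis using *[OF GL_mult[OF that R(1)]] by argo
  qed
  then have "GL_orbit k B \<subseteq> GL_orbit k (Q * B)"
    unfolding GL_orbit_def using GL_mult[OF _ R(1)] by blast
  moreover have "GL_orbit k (Q * B) \<subseteq> GL_orbit k B"
    unfolding GL_orbit_def using * GL_mult[OF _ Q] by blast
  ultimately show ?thesis by blast
qed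

lemma GL_orbit_right_mult:
  assumes "B \<in> carrier_mat k n" "D \<in> carrier_mat n m"
  shows "(\<lambda>A. A * D) ` GL_orbit k B = GL_orbit k (B * D)"
proof -
  have "P * B * D = P * (B * D)" if "P \<in> GL k" for P
    using that assms GL_carrier by (intro assoc_mult_mat) auto
  then show ?thesis by (auto simp: GL_orbit_def image_image cong: image_cong_simp)
qed

section \<open>Cyclic fixed points\<close>

lemma rho_carrier: "transpose_mat (rho n) \<in> carrier_mat n n"
  by (auto simp: rho_def)

lemma cyc_shift_GL_orbit:
  assumes B: "B \<in> carrier_mat k n"
  shows "cyc_shift ` GL_orbit k B = GL_orbit k (cyc_shift B)"
proof -
  have "cyc_shift ` GL_orbit k B = (\<lambda>A. A * transpose_mat (rho n)) ` GL_orbit k B"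
    using B by (intro image_cong refl cyc_shift_eq_mult[of _ k])
      (auto simp: GL_orbit_def dest: GL_carrier)
  then show ?thesis using B by (simp add: GL_orbit_right_mult[OF _ rho_carrier] cyc_shift_eq_mult)
qed

lemma GL_orbit_cyclic_fixed:
  assumes "B \<in> X_mats k n" "k \<le> n" "Q \<in> GL k" "cyc_shift B = Q * B"
  shows "GL_orbit k B \<in> cyclic_fixed_points_G k n"
  using assms X_mats_carrier[OF assms(1)]
  by (simp add: cyclic_fixed_points_G_def GL_orbit_in_Gr cyc_shift_GL_orbit GL_orbit_left_mult)

lemma cyc_shift_right_diag:
  assumes A: "A \<in> carrier_mat k n"
  shows "cyc_shift (A * mat_diag n e) = cyc_shift A * mat_diag n (\<lambda>j. e (Suc j mod n))"
proof -
  have "cyc_shift A \<in> carrier_mat k n" using A by (auto simp: cyc_shift_def)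
  then show ?thesis
    unfolding mat_diag_mult_right[OF A] using A
    by (subst mat_diag_mult_right) (auto simp: cyc_shift_def)
qed

text \<open>This one computation is used twice: with \<open>e\<close> chosen to turn the factors \<open>t\<close> into a constant,
  and with \<open>t = 1\<close>, \<open>e j = q\<^sup>j\<^sup>a\<close> and \<open>c = q\<^sup>a\<close> to show that \<open>T\<^sub>n\<close> preserves fixedness.\<close>

lemma cyc_shift_rescale:
  assumes A: "A \<in> carrier_mat k n" and Q: "Q \<in> carrier_mat k k"
    and shift: "cyc_shift A = Q * A * mat_diag n t"
    and e: "\<And>j. j < n \<Longrightarrow> t j * e (Suc j mod n) = c * e j"
  shows "cyc_shift (A * mat_diag n e) = (c \<cdot>\<^sub>m Q) * (A * mat_diag n e)"
proof -
  have "cyc_shift (A * mat_diag n e) = Q * A * (mat_diag n (\<lambda>j. t j * e (Suc j mod n)))"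
    using A Q by (simp add: cyc_shift_right_diag shift assoc_mult_mat[of "Q * A" k n _ n _ n])
  also have "mat_diag n (\<lambda>j. t j * e (Suc j mod n)) = c \<cdot>\<^sub>m mat_diag n e"
    using e by (intro eq_matI) (auto simp: mat_diag_def)
  also have "Q * A * (c \<cdot>\<^sub>m mat_diag n e) = c \<cdot>\<^sub>m (Q * A * mat_diag n e)"
    using A Q by (intro mult_smult_distrib[of _ k n _ n]) auto
  also have "Q * A * mat_diag n e = Q * (A * mat_diag n e)"
    using A Q by (intro assoc_mult_mat[of _ k k _ n _ n]) auto
  also have "c \<cdot>\<^sub>m \<dots> = (c \<cdot>\<^sub>m Q) * (A * mat_diag n e)"
    using A Q by (intro mult_smult_assoc_mat[of _ k k _ n, symmetric]) auto
  finally show ?thesis .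
qed

text \<open>Solving the recursion \<open>e (j + 1) = c * e j / t j\<close> from \<open>e 0 = 1\<close> leaves only the condition
  \<open>e n = 1\<close> at the wrap-around, which is \<open>c ^ n = (\<Prod>j<n. t j)\<close>.\<close>

lemma constant_cocycle_representative:
  fixes t :: "nat \<Rightarrow> complex"
  assumes n: "n > 0" and t: "\<And>j. j < n \<Longrightarrow> t j \<noteq> 0"
  obtains c e where "c \<noteq> 0" "\<And>j. j < n \<Longrightarrow> e j \<noteq> 0"
    "\<And>j. j < n \<Longrightarrow> t j * e (Suc j mod n) = c * e j"
proof -
  obtain c where c: "c ^ n = (\<Prod>j<n. t j)" using complex_root_exists[OF n] .
  have nz: "(\<Prod>i<j. t i) \<noteq> 0" if "j \<le> n" for j using t that by auto
  have c0: "c \<noteq> 0" using c nz[of n] n by (auto simp: power_0_left)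
  define e where "e j = c ^ j / (\<Prod>i<j. t i)" for j
  have wrap: "e (Suc j mod n) = e (Suc j)" if "j < n" for j
  proof (cases "Suc j = n")
    case True
    then show ?thesis using c nz[of n] by (simp add: e_def)
  qed (use that in auto)
  show thesis
  proof (rule that)
    show "e j \<noteq> 0" if "j < n" for j using nz[of j] c0 that by (simp add: e_def)
    show "t j * e (Suc j mod n) = c * e j" if "j < n" for j
      using nz[of j] t[OF that] that by (simp add: wrap) (simp add: e_def)
  qed (rule c0)
qed

lemma root_q_power: "root_q n ^ a = cis (2 * pi * real a / real n)"
  by (simp add: root_q_def cis_conv_exp flip: exp_of_nat_mult) (simp add: field_simps)

lemma root_q_nonzero: "root_q n \<noteq> 0"
  by (simp add: root_q_def)

lemma root_q_power_n: "n > 0 \<Longrightarrow> root_q n ^ n = 1"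
  by (simp add: root_q_power)

lemma root_q_power_inj: "n > 0 \<Longrightarrow> inj_on (\<lambda>a. root_q n ^ a) {..<n}"
  unfolding root_q_power using bij_betw_roots_unity by (rule bij_betw_imp_inj_on)

lemma T_orbit_GL_orbit:
  assumes "B \<in> carrier_mat k n"
  shows "T_orbit n (GL_orbit k B) = (\<lambda>a. GL_orbit k (B * mat_diag n (\<lambda>j. root_q n ^ (j * a)))) ` {..<n}"
proof -
  have "T_group n = (\<lambda>a. mat_diag n (\<lambda>j. root_q n ^ (j * a))) ` {..<n}"
    by (auto simp: T_group_def)
  then show ?thesis using assms
    by (simp add: T_orbit_def image_image GL_orbit_right_mult[of B k n _ n])
qed

text \<open>If \<open>a\<close> and \<open>b\<close> give the same point of the \<open>T\<^sub>n\<close>-orbit, then the diagonal matrix with entries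
  \<open>q\<^sup>j\<^sup>b / q\<^sup>j\<^sup>a\<close> fixes the class of \<open>B\<close>, so it is scalar; comparing its entries at \<open>j = 0\<close> and
  \<open>j = 1\<close> gives \<open>q\<^sup>a = q\<^sup>b\<close>.\<close>

lemma GL_orbit_aperiodic:
  assumes B: "B \<in> X_mats k n" and k: "1 \<le> k" "k < n" and Q: "Q \<in> GL k"
    and shift: "cyc_shift B = Q * B"
  shows "GL_orbit k B \<in> aperiodic_fixed_points_G k n"
proof -
  let ?q = "root_q n"
  let ?D = "\<lambda>a. mat_diag n (\<lambda>j. ?q ^ (j * a))"
  have n: "n > 0" using k by simp
  have c: "B \<in> carrier_mat k n" using B by (rule X_mats_carrier)
  have D: "?D a \<in> torus n" for a by (intro mat_diag_in_torus) (simp add: root_q_nonzero)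
  have fixed: "GL_orbit k (B * ?D a) \<in> cyclic_fixed_points_G k n" for a
  proof (rule GL_orbit_cyclic_fixed)
    show "B * ?D a \<in> X_mats k n" using B D by (rule X_mats_right_mult)
    show "?q ^ a \<cdot>\<^sub>m Q \<in> GL k" using Q by (intro GL_smult) (simp_all add: root_q_nonzero)
    have "?q ^ (Suc j mod n * a) = ?q ^ a * ?q ^ (j * a)" if "j < n" for j
    \<comment> \<open>The wrap-around from the last column to the first is consistent because \<open>q ^ n = 1\<close>.\<close>
    proof (cases "Suc j = n")
      case True
      then have "?q ^ a * ?q ^ (j * a) = (?q ^ n) ^ a" by (auto simp flip: power_add power_mult)
      then show ?thesis using True root_q_power_n[OF n] by simp
    qed (use that in \<open>simp add: power_add\<close>)
    moreover have "cyc_shift B = Q * B * mat_diag n (\<lambda>_. 1)"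
      using shift c GL_carrier[OF Q] by simp
    ultimately show "cyc_shift (B * ?D a) = (?q ^ a \<cdot>\<^sub>m Q) * (B * ?D a)"
      using c GL_carrier[OF Q] by (intro cyc_shift_rescale) auto
  qed (use k in simp)
  have "inj_on (\<lambda>a. GL_orbit k (B * ?D a)) {..<n}"
  proof (rule inj_onI)
    fix a b assume ab: "a \<in> {..<n}" "b \<in> {..<n}"
      and "GL_orbit k (B * ?D a) = GL_orbit k (B * ?D b)"
    then have "B * ?D b \<in> GL_orbit k (B * ?D a)"
      using GL_orbit_self[of "B * ?D b" k n] c by simp
    then obtain R where R: "R \<in> GL k" "B * ?D b = R * (B * ?D a)" by (auto simp: GL_orbit_def)
    define E where "E = mat_diag n (\<lambda>j. inverse (?q ^ (j * a)))"
    have E: "E \<in> carrier_mat n n" "?D a * E = 1\<^sub>m n"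
      by (auto simp: E_def root_q_nonzero intro!: mat_diag_eq_oneI)
    have "R * B = R * (B * (?D a * E))" using E c by simp
    also have "\<dots> = B * ?D b * E"
      using R(2) GL_carrier[OF R(1)] c E(1)
      by (simp add: assoc_mult_mat[of _ k k _ n _ n] assoc_mult_mat[of _ k n _ n _ n])
    also have "\<dots> = B * mat_diag n (\<lambda>j. ?q ^ (j * b) * inverse (?q ^ (j * a)))"
      using c by (simp add: E_def assoc_mult_mat[of _ k n _ n _ n])
    finally have "?q ^ (0 * b) * inverse (?q ^ (0 * a)) = ?q ^ (1 * b) * inverse (?q ^ (1 * a))"
      using k R by (intro torus_stabilizer_scalar[OF B k]) (auto simp: root_q_nonzero GL_carrier)
    then have "?q ^ a = ?q ^ b" by (simp add: root_q_nonzero field_simps)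
    then show "a = b" using root_q_power_inj[OF n] ab by (auto dest: inj_onD)
  qed
  then have "card (T_orbit n (GL_orbit k B)) = n"
    using c by (simp add: T_orbit_GL_orbit card_image)
  moreover have "GL_orbit k B \<in> cyclic_fixed_points_G k n"
    using k by (intro GL_orbit_cyclic_fixed[OF B _ Q shift]) simp
  ultimately show ?thesis
    using fixed c by (auto simp: aperiodic_fixed_points_G_def T_orbit_GL_orbit)
qed

lemma cyclic_fixed_point_contains_aperiodic:
  assumes k: "1 \<le> k" "k < n" and x: "x \<in> cyclic_fixed_points_X k n"
  obtains p where "p \<in> aperiodic_fixed_points_G k n" "p \<subseteq> x"
proof -
  have k0: "k > 0" using k by simp
  note eq = equiv_X_rel[OF k0, of n]
  have xX: "x \<in> X_mats k n // X_rel k n" and fixed: "cyc_shift ` x = x"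
    using x by (auto simp: cyclic_fixed_points_X_def X_space_def)
  obtain A where A: "A \<in> x" using in_quotient_imp_non_empty[OF eq xX] by auto
  then have "(A, cyc_shift A) \<in> X_rel k n"
    using fixed by (intro in_quotient_imp_in_rel[OF eq xX]) auto
  then obtain Q D where AX: "A \<in> X_mats k n" and Q: "Q \<in> GL k" and D: "D \<in> torus n"
    and shift: "cyc_shift A = Q * A * D" by (auto simp: X_rel_iff[OF k0])
  obtain t where t: "D = mat_diag n t" "\<And>j. j < n \<Longrightarrow> t j \<noteq> 0" using D by (auto simp: torus_def)
  obtain c e where c: "c \<noteq> 0" and e0: "\<And>j. j < n \<Longrightarrow> e j \<noteq> 0"
    and e: "\<And>j. j < n \<Longrightarrow> t j * e (Suc j mod n) = c * e j"
    using constant_cocycle_representative[of n t] k t(2) by (metis not_less_zero gr0I)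
  define B where "B = A * mat_diag n e"
  have E: "mat_diag n e \<in> torus n" using e0 by (rule mat_diag_in_torus)
  have "cyc_shift B = (c \<cdot>\<^sub>m Q) * B"
    unfolding B_def using AX Q e shift t(1) X_mats_carrier GL_carrier by (intro cyc_shift_rescale) auto
  then have "GL_orbit k B \<in> aperiodic_fixed_points_G k n"
    using X_mats_right_mult[OF AX E] GL_smult[OF Q c] k unfolding B_def[symmetric]
    by (intro GL_orbit_aperiodic) auto
  moreover have "P * B \<in> x" if P: "P \<in> GL k" for P
    using X_space_two_sided_mult[OF k0 _ A P E] xX X_mats_carrier[OF AX] GL_carrier[OF P]
    by (simp add: B_def X_space_def assoc_mult_mat[of P k k A n _ n])
  then have "GL_orbit k B \<subseteq> x" by (auto simp: GL_orbit_def)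
  ultimately show thesis by (rule that)
qed

lemma T_group_subset_torus: "T_group n \<subseteq> torus n"
  by (auto simp: T_group_def root_q_nonzero intro: mat_diag_in_torus)

lemma T_orbit_stays_in_class:
  assumes k: "k > 0" and x: "x \<in> X_space k n" and "p \<subseteq> x" "p' \<in> T_orbit n p"
  shows "p' \<subseteq> x"
proof
  fix B assume "B \<in> p'"
  then obtain A D where AD: "A \<in> x" "D \<in> torus n" "B = A * D"
    using assms T_group_subset_torus by (fastforce simp: T_orbit_def)
  then have "A \<in> carrier_mat k n"
    using in_quotient_imp_subset[OF equiv_X_rel[OF k]] x X_mats_carrier by (fastforce simp: X_space_def)
  then show "B \<in> x" using X_space_two_sided_mult[OF k x AD(1) GL_one AD(2)] AD(3) by simp
qed

theorem theorem5p3: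
  fixes k n :: nat
  assumes "2 \<le> k" and "k \<le> n - 2"
  shows "\<exists>f. inj_on f (cyclic_fixed_points_X k n)
           \<and> f ` cyclic_fixed_points_X k n \<subseteq> aperiodic_orbits k n
           \<and> (\<forall>x \<in> cyclic_fixed_points_X k n. \<forall>p \<in> f x. p \<subseteq> x)"
proof -
  have k: "k > 0" "1 \<le> k" "k < n" using assms by auto
  let ?C = "cyclic_fixed_points_X k n"
  have "\<forall>x\<in>?C. \<exists>p. p \<in> aperiodic_fixed_points_G k n \<and> p \<subseteq> x"
    using cyclic_fixed_point_contains_aperiodic[OF k(2,3)] by metis
  then obtain p where p: "\<And>x. x \<in> ?C \<Longrightarrow> p x \<in> aperiodic_fixed_points_G k n"
    "\<And>x. x \<in> ?C \<Longrightarrow> p x \<subseteq> x" by metis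
  define f where "f x = T_orbit n (p x)" for x
  have CX: "x \<in> X_space k n" if "x \<in> ?C" for x using that by (simp add: cyclic_fixed_points_X_def)
  have sub: "q \<subseteq> x" if "x \<in> ?C" "q \<in> f x" for x q
    using T_orbit_stays_in_class[OF k(1) CX p(2)] that by (auto simp: f_def)
  \<comment> \<open>Containment of orbit points in two classes separates the classes only if some orbit point has
    an element.\<close>
  have nonempty: "\<exists>q A. q \<in> f x \<and> A \<in> q" if x: "x \<in> ?C" for x
  proof -
    have "card (f x) = n" "f x \<subseteq> Gr k n"
      using p(1)[OF x] by (auto simp: aperiodic_fixed_points_G_def cyclic_fixed_points_G_def f_def)
    moreover have "f x \<noteq> {}" using \<open>card (f x) = n\<close> k by auto
    ultimately obtain q where "q \<in> f x" "q \<in> Gr k n" by blast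
    then show ?thesis using Gr_nonempty by blast
  qed
  have "inj_on f ?C"
  proof (rule inj_onI)
    fix x y assume xy: "x \<in> ?C" "y \<in> ?C" "f x = f y"
    obtain q A where "q \<in> f x" "A \<in> q" using nonempty[OF xy(1)] by blast
    then have "A \<in> x \<inter> y" using sub[OF xy(1)] sub[OF xy(2)] xy(3) by auto
    then show "x = y"
      using quotient_disj[OF equiv_X_rel[OF k(1)], of x n y] CX xy by (auto simp: X_space_def)
  qed
  moreover have "f ` ?C \<subseteq> aperiodic_orbits k n" using p by (auto simp: f_def aperiodic_orbits_def)
  ultimately show ?thesis using sub by blast
qed

end
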